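(* Let $G$ be a countable abelian group, let $X$ be a compact metric space, let $G\curvearrowright X$ be a continuous action, and let $\mu$ be an ergodic Borel probability measure on $X$. Let $(x,y)\in X^2$. Then $(x,y)$ is an $IN_\mu$ pair if and only if it is a $\mathcal{B}$-$IN_\mu$ pair.
   Context: Here $G$ is discrete; a continuous action means that $x\mapsto sx$ is continuous for every $s\in G$. A Borel probability measure $\mu$ is ergodic if it is $G$-invariant and every $G$-invariant Borel set has measure $0$ or $1$. $\mathcal{B}(X)$ is the set of Borel subsets of $X$. Let $(A_1,A_2)$ be a pair of subsets of $X$ and let $E:G\to 2^X$ be a map into the power set of $X$. A set $I\subseteq G$ is an independence set for $(A_1,A_2)$ relative to $E$ if for every nonempty finite $F\subseteq I$ and every map $\sigma:F\to\{1,2\}$ we have $\bigcap_{s\in F}(E(s)\cap s^{-1}A_{\sigma(s)})\neq\emptyset$. For a set $D\subseteq X$, an independence set relative to $D$ means an independence set relative to the constant map $E(s)=D$. For $\varepsilon>0$, $\mathcal{B}'_\mu(X,\varepsilon)$ is the set of all maps $E:G\to\mathcal{B}(X)$ with $\mu(E(s))\ge 1-\varepsilon$ for all $s\in G$, and $\mathcal{B}_\mu(X,\varepsilon)=\{D\in\mathcal{B}(X):\mu(D)\ge 1-\varepsilon\}$. $(A_1,A_2)$ has $(\varepsilon,\mu)$-independence over arbitrarily large finite sets if there exists $c>0$ such that for every $N>0$ there is a finite set $F\subseteq G$ with $|F|>N$ such that for every $E\in\mathcal{B}'_\mu(X,\varepsilon)$ there is an independence set $I\subseteq F$ for $(A_1,A_2)$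 relative to $E$ with $|I|\ge c|F|$. $(A_1,A_2)$ has $\mathcal{B}$-$(\varepsilon,\mu)$-independence over arbitrarily large finite sets if there exists $c>0$ such that for every $N>0$ there is a finite set $F\subseteq G$ with $|F|>N$ such that for every $D\in\mathcal{B}_\mu(X,\varepsilon)$ there is an independence set $I\subseteq F$ for $(A_1,A_2)$ relative to $D$ with $|I|\ge c|F|$. $(x,y)\in X^2$ is an $IN_\mu$ pair (respectively, a $\mathcal{B}$-$IN_\mu$ pair) if for all neighbourhoods $U_x$ of $x$ and $U_y$ of $y$ there exists $\varepsilon>0$ such that $(U_x,U_y)$ has $(\varepsilon,\mu)$-independence (respectively, $\mathcal{B}$-$(\varepsilon,\mu)$-independence) over arbitrarily large finite sets. *)

theory Defs
  imports "HOL-Analysis.Analysis" "HOL-Probability.Probability"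
begin

text \<open>
  The acting group is a type of class \<open>group_add\<close>, so it is written additively: the unit is \<open>0\<close> and
  the inverse of \<open>s\<close> is \<open>- s\<close>. The space is a topological (later: compact metric) type, with Borel
  sets \<open>sets borel\<close>.
\<close>

definition continuous_action :: "('g::group_add \<Rightarrow> 'x::topological_space \<Rightarrow> 'x) \<Rightarrow> bool" where
  "continuous_action act \<longleftrightarrow>
     (\<forall>x. act 0 x = x) \<and>
     (\<forall>s t x. act (s + t) x = act s (act t x)) \<and>
     (\<forall>s. continuous_on UNIV (act s))"

definition ergodic_measure ::
  "('g::group_add \<Rightarrow> 'x::topological_space \<Rightarrow> 'x) \<Rightarrow> 'x measure \<Rightarrow> bool" where
  "ergodic_measure act \<mu> \<longleftrightarrow>
     prob_space \<mu> \<and> sets \<mu> = sets borel \<and>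
     (\<forall>s. \<forall>A\<in>sets borel. measure \<mu> (act s ` A) = measure \<mu> A) \<and>
     (\<forall>A\<in>sets borel. (\<forall>s. act s ` A = A) \<longrightarrow> measure \<mu> A = 0 \<or> measure \<mu> A = 1)"

text \<open>The set \<open>s\<inverse>A\<close> is rendered as \<open>act (- s) ` A\<close>; for an action it equals \<open>act s -` A\<close>.\<close>

definition independence_set ::
  "('g::group_add \<Rightarrow> 'x \<Rightarrow> 'x) \<Rightarrow> 'x set \<Rightarrow> 'x set \<Rightarrow> ('g \<Rightarrow> 'x set) \<Rightarrow> 'g set \<Rightarrow> bool" where
  "independence_set act A1 A2 E I \<longleftrightarrow>
     (\<forall>F \<sigma>. F \<subseteq> I \<and> finite F \<and> F \<noteq> {} \<and> \<sigma> \<in> F \<rightarrow> {1, 2::nat} \<longrightarrow>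
        (\<Inter>s\<in>F. E s \<inter> act (- s) ` (if \<sigma> s = 1 then A1 else A2)) \<noteq> {})"

definition large_set_maps ::
  "'x::topological_space measure \<Rightarrow> real \<Rightarrow> ('g \<Rightarrow> 'x set) set" where
  "large_set_maps \<mu> \<epsilon> = {E. \<forall>s. E s \<in> sets borel \<and> measure \<mu> (E s) \<ge> 1 - \<epsilon>}"

definition large_sets :: "'x::topological_space measure \<Rightarrow> real \<Rightarrow> 'x set set" where
  "large_sets \<mu> \<epsilon> = {D \<in> sets borel. measure \<mu> D \<ge> 1 - \<epsilon>}"

definition has_independence ::
  "('g::group_add \<Rightarrow> 'x::topological_space \<Rightarrow> 'x) \<Rightarrow> 'x measure \<Rightarrow> real \<Rightarrow>
     'x set \<Rightarrow> 'x set \<Rightarrow> bool" where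
  "has_independence act \<mu> \<epsilon> A1 A2 \<longleftrightarrow>
     (\<exists>c::real. c > 0 \<and>
        (\<forall>N::nat. N > 0 \<longrightarrow>
           (\<exists>F. finite F \<and> card F > N \<and>
              (\<forall>E\<in>large_set_maps \<mu> \<epsilon>.
                 \<exists>I\<subseteq>F. independence_set act A1 A2 E I \<and> real (card I) \<ge> c * real (card F)))))"

definition has_B_independence ::
  "('g::group_add \<Rightarrow> 'x::topological_space \<Rightarrow> 'x) \<Rightarrow> 'x measure \<Rightarrow> real \<Rightarrow>
     'x set \<Rightarrow> 'x set \<Rightarrow> bool" where
  "has_B_independence act \<mu> \<epsilon> A1 A2 \<longleftrightarrow>
     (\<exists>c::real. c > 0 \<and>
        (\<forall>N::nat. N > 0 \<longrightarrow>
           (\<exists>F. finite F \<and> card F > N \<and>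
              (\<forall>D\<in>large_sets \<mu> \<epsilon>.
                 \<exists>I\<subseteq>F. independence_set act A1 A2 (\<lambda>_. D) I \<and>
                      real (card I) \<ge> c * real (card F)))))"

text \<open>Neighbourhoods of \<open>x\<close> need not be open: they are the sets with \<open>x\<close> in their interior.\<close>

definition IN_pair ::
  "('g::group_add \<Rightarrow> 'x::topological_space \<Rightarrow> 'x) \<Rightarrow> 'x measure \<Rightarrow> 'x \<times> 'x \<Rightarrow> bool" where
  "IN_pair act \<mu> p \<longleftrightarrow>
     (\<forall>U V. fst p \<in> interior U \<and> snd p \<in> interior V \<longrightarrow>
        (\<exists>\<epsilon>>0. has_independence act \<mu> \<epsilon> U V))"

definition B_IN_pair ::
  "('g::group_add \<Rightarrow> 'x::topological_space \<Rightarrow> 'x) \<Rightarrow> 'x measure \<Rightarrow> 'x \<times> 'x \<Rightarrow> bool" where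
  "B_IN_pair act \<mu> p \<longleftrightarrow>
     (\<forall>U V. fst p \<in> interior U \<and> snd p \<in> interior V \<longrightarrow>
        (\<exists>\<epsilon>>0. has_B_independence act \<mu> \<epsilon> U V))"

end

theory Submission
  imports Defs
begin

text \<open>
  An \<open>IN\<close> pair is a \<open>\<B>\<close>-\<open>IN\<close> pair because a single large set is a constant map. For the converse,
  suppose that \<open>(U, V)\<close> is independent over a finite set \<open>F\<close>, with density \<open>c\<close>, relative to every
  single set of measure at least \<open>1 - \<epsilon>\<close>. Given a map \<open>E\<close> whose values have measure at least
  \<open>1 - \<epsilon> * c / 32\<close>, let \<open>D\<close> consist of the points that miss at most \<open>c / 32 * |F|\<close> of the sets \<open>E s\<close>,
  \<open>s \<in> F\<close>. Markov's inequality gives \<open>\<mu> D \<ge> 1 - \<epsilon>\<close> (lemma \<open>measure_in_most_ge\<close>), so some \<open>I \<subseteq> F\<close>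
  with \<open>|I| \<ge> c * |F|\<close> is an independence set relative to \<open>D\<close>.

  A choice of \<open>U\<close> or \<open>V\<close> at each place of \<open>I\<close> is encoded by the set \<open>S \<subseteq> I\<close> of the places where \<open>U\<close>
  is chosen. Each \<open>S\<close> is realised by a point of \<open>D\<close>, and this point lies in \<open>E s\<close> for all \<open>s \<in> I\<close>
  outside a bad set \<open>b S\<close> that contains at most a thirty-second part of \<open>I\<close>. So few subsets of \<open>I\<close>
  are this small that a large family of \<open>S\<close> shares one bad set \<open>B\<close>. By Pajor's form of the
  Sauer-Shelah lemma (\<open>card_le_card_shattered\<close>) this family shatters a set \<open>J\<close> larger than \<open>B\<close> by a
  fixed proportion of \<open>I\<close>. On \<open>J - B\<close> all choices are still realised, now by points that lie in \<open>E s\<close>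
  for every \<open>s \<in> J - B\<close>. Hence \<open>J - B\<close> is an independence set relative to \<open>E\<close>, of density at least
  \<open>c / 16\<close> in the same set \<open>F\<close>.
\<close>

section \<open>Shattered sets\<close>

definition shatters :: "'a set set \<Rightarrow> 'a set \<Rightarrow> bool" where
  "shatters \<S> J \<longleftrightarrow> (\<forall>K\<subseteq>J. \<exists>S\<in>\<S>. S \<inter> J = K)"

text \<open>
  Split the family by membership of a point \<open>a\<close> and delete \<open>a\<close>. A set shattered by one of the two
  halves is shattered by the whole, and if both halves shatter it then the whole also shatters it
  with \<open>a\<close> added. So the numbers of shattered sets of the two halves add up, as the cardinalities do.
\<close>

lemma card_le_card_shattered:
  assumes "finite A" and "\<S> \<subseteq> Pow A"
  shows "card \<S> \<le> card {J. J \<subseteq> A \<and> shatters \<S> J}"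
  using assms
proof (induction A arbitrary: \<S> rule: finite_induct)
  case empty
  show ?case
  proof (cases "\<S> = {}")
    case False
    with empty have "\<S> = {{}}" by (simp add: subset_singleton_iff)
    then have "{J. J \<subseteq> {} \<and> shatters \<S> J} = {{}}"
      by (auto simp: shatters_def)
    with \<open>\<S> = {{}}\<close> show ?thesis by simp
  qed simp
next
  case (insert a A)
  define \<S>0 where "\<S>0 = {S\<in>\<S>. a \<notin> S}"
  define \<S>1 where "\<S>1 = (\<lambda>S. S - {a}) ` {S\<in>\<S>. a \<in> S}"
  define Sh where "Sh \<T> = {J. J \<subseteq> A \<and> shatters \<T> J}" for \<T>
  have fin: "finite \<S>"
    using insert.prems insert.hyps(1) by (meson finite_Pow_iff finite_insert finite_subset)
  have finSh: "finite (Sh \<T>)" for \<T>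
    unfolding Sh_def using insert.hyps(1) by simp
  have "inj_on (\<lambda>S. S - {a}) {S\<in>\<S>. a \<in> S}"
    by (auto simp: inj_on_def)
  then have c1: "card \<S>1 = card {S\<in>\<S>. a \<in> S}"
    unfolding \<S>1_def by (rule card_image)
  have "card \<S> = card ({S\<in>\<S>. a \<notin> S} \<union> {S\<in>\<S>. a \<in> S})"
    by (rule arg_cong[where f = card]) blast
  also have "\<dots> = card \<S>0 + card \<S>1"
    unfolding c1 \<S>0_def using fin by (intro card_Un_disjoint) auto
  also have "\<dots> \<le> card (Sh \<S>0) + card (Sh \<S>1)"
    unfolding Sh_def using insert.prems
    by (intro add_mono insert.IH) (auto simp: \<S>0_def \<S>1_def)
  also have "\<dots> = card (Sh \<S>0 \<union> Sh \<S>1) + card (Sh \<S>0 \<inter> Sh \<S>1)"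
    using finSh by (intro card_Un_Int) auto
  also have "card (Sh \<S>0 \<inter> Sh \<S>1) = card (insert a ` (Sh \<S>0 \<inter> Sh \<S>1))"
  proof (rule card_image[symmetric])
    show "inj_on (insert a) (Sh \<S>0 \<inter> Sh \<S>1)"
      using insert.hyps(2) unfolding inj_on_def Sh_def
      by (metis (no_types, lifting) Int_iff insert_ident mem_Collect_eq subsetD)
  qed
  also have "card (Sh \<S>0 \<union> Sh \<S>1) + card (insert a ` (Sh \<S>0 \<inter> Sh \<S>1))
      = card ((Sh \<S>0 \<union> Sh \<S>1) \<union> insert a ` (Sh \<S>0 \<inter> Sh \<S>1))"
    using finSh insert.hyps(2) by (intro card_Un_disjoint[symmetric]) (auto simp: Sh_def)
  also have "\<dots> \<le> card {J. J \<subseteq> insert a A \<and> shatters \<S> J}"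
  proof (rule card_mono)
    show "finite {J. J \<subseteq> insert a A \<and> shatters \<S> J}"
      using insert.hyps(1) by simp
    have sh0: "J \<subseteq> A \<and> shatters \<S> J" if "J \<in> Sh \<S>0" for J
      using that unfolding Sh_def shatters_def \<S>0_def by blast
    have sh1: "J \<subseteq> A \<and> shatters \<S> J" if "J \<in> Sh \<S>1" for J
    proof -
      have "\<exists>S\<in>\<S>. S \<inter> J = K" if "K \<subseteq> J" for K
      proof -
        obtain S where "S \<in> \<S>" "(S - {a}) \<inter> J = K"
          using \<open>J \<in> Sh \<S>1\<close> \<open>K \<subseteq> J\<close> unfolding Sh_def shatters_def \<S>1_def by blast
        moreover have "a \<notin> J"
          using \<open>J \<in> Sh \<S>1\<close> insert.hyps(2) unfolding Sh_def by blast
        ultimately show ?thesis by blast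
      qed
      with that show ?thesis unfolding Sh_def shatters_def by blast
    qed
    have sh2: "shatters \<S> (insert a J)" if J: "J \<in> Sh \<S>0 \<inter> Sh \<S>1" for J
      unfolding shatters_def
    proof (intro allI impI)
      fix K assume K: "K \<subseteq> insert a J"
      then have KJ: "K - {a} \<subseteq> J" by blast
      have aJ: "a \<notin> J"
        using J insert.hyps(2) unfolding Sh_def by blast
      show "\<exists>S\<in>\<S>. S \<inter> insert a J = K"
      proof (cases "a \<in> K")
        case True
        have "shatters \<S>1 J" using J unfolding Sh_def by simp
        with KJ obtain T where "T \<in> \<S>1" "T \<inter> J = K - {a}"
          unfolding shatters_def by blast
        then obtain S where "S \<in> \<S>" "a \<in> S" "(S - {a}) \<inter> J = K - {a}"
          unfolding \<S>1_def by blast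
        with True aJ show ?thesis by (intro bexI[of _ S]) auto
      next
        case False
        have "shatters \<S>0 J" using J unfolding Sh_def by simp
        with KJ obtain S where "S \<in> \<S>" "a \<notin> S" "S \<inter> J = K - {a}"
          unfolding shatters_def \<S>0_def by blast
        with False show ?thesis by (intro bexI[of _ S]) auto
      qed
    qed
    show "(Sh \<S>0 \<union> Sh \<S>1) \<union> insert a ` (Sh \<S>0 \<inter> Sh \<S>1) \<subseteq> {J. J \<subseteq> insert a A \<and> shatters \<S> J}"
      using sh0 sh1 sh2 by blast
  qed
  finally show ?case .
qed

section \<open>Shattering with unreliable subsets\<close>

text \<open>
  The weights \<open>(1/4)^|J|\<close> of all \<open>J \<subseteq> A\<close> sum to \<open>(1 + 1/4)^|A|\<close>, and each set counted here has
  weight at least \<open>(1/4)^k\<close>.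
\<close>

lemma card_small_subsets_le:
  assumes "finite A"
  shows "real (card {J. J \<subseteq> A \<and> card J \<le> k}) \<le> (5/4) ^ card A * 4 ^ k"
proof -
  have "real (card {J. J \<subseteq> A \<and> card J \<le> k}) * (1/4) ^ k
      = (\<Sum>J\<in>{J. J \<subseteq> A \<and> card J \<le> k}. (1/4) ^ k)"
    by simp
  also have "\<dots> \<le> (\<Sum>J\<in>{J. J \<subseteq> A \<and> card J \<le> k}. (1/4) ^ card J)"
    by (intro sum_mono power_decreasing) auto
  also have "\<dots> \<le> (\<Sum>J\<in>Pow A. (1/4::real) ^ card J)"
    using assms by (intro sum_mono2) auto
  also have "\<dots> = (\<Prod>i\<in>A. 1/4 + 1)"
    using assms by (subst prod_add) auto
  also have "\<dots> = (5/4) ^ card A"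
    by simp
  finally show ?thesis
    by (simp add: power_divide field_simps)
qed

text \<open>
  This is the numerical reason for the constants 1/32 and 3/32 below: subsets of these relative
  sizes are so rare that even pairs of them do not exhaust the \<open>2^m\<close> subsets of an \<open>m\<close>-element set.
  The estimate is checked after taking eighth powers.
\<close>

lemma counting_bound:
  assumes "8 * j \<le> m" and "0 < m"
  shows "(5/4) ^ m * (5/4) ^ m * 4 ^ j < (2::real) ^ m"
proof -
  have "((5/4) ^ m * (5/4) ^ m * 4 ^ j) ^ 8 = ((5/4) ^ 16) ^ m * (4::real) ^ (8 * j)"
    by (simp add: power_mult_distrib flip: power_mult power_add)
  also have "\<dots> \<le> ((5/4) ^ 16) ^ m * 4 ^ m"
    using assms(1) by (intro mult_left_mono power_increasing) auto
  also have "\<dots> = ((5/4) ^ 16 * 4) ^ m"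
    by (simp only: power_mult_distrib)
  also have "\<dots> < (256::real) ^ m"
    using assms(2) by (intro power_strict_mono) (auto simp: eval_nat_numeral)
  also have "\<dots> = (2 ^ m) ^ 8"
    by (simp add: power_mult [symmetric] mult.commute[of m 8]) (simp add: power_mult)
  finally show ?thesis
    by (rule power_less_imp_less_base) simp
qed

text \<open>
  The full power set of \<open>I\<close> shatters \<open>I\<close>. If every \<open>S \<subseteq> I\<close> is unreliable on a small set \<open>b S\<close>, then
  the subsets that are reliable throughout a suitable \<open>J\<close> of positive density still shatter \<open>J\<close>.
\<close>

lemma reliable_subsets_shatter:
  assumes fin: "finite I"
    and b: "\<And>S. S \<subseteq> I \<Longrightarrow> b S \<subseteq> I \<and> 32 * card (b S) \<le> card I"
  shows "\<exists>J\<subseteq>I. card I \<le> 16 * card J \<and> shatters {S. S \<subseteq> I \<and> b S \<inter> J = {}} J"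
proof (cases "I = {}")
  case True
  then show ?thesis using b by (intro exI[of _ "{}"]) (auto simp: shatters_def)
next
  case False
  define m where "m = card I"
  define l where "l = m div 32"
  define k where "k = 3 * m div 32"
  have m: "0 < m" using False fin by (simp add: m_def card_gt_0_iff)
  define small where "small r = {J. J \<subseteq> I \<and> card J \<le> r}" for r
  define \<S> where "\<S> B = {S. S \<subseteq> I \<and> b S = B}" for B
  have finsmall: "finite (small r)" for r
    unfolding small_def using fin by simp
  have bsmall: "b S \<in> small l" if "S \<subseteq> I" for S
    using b[OF that] unfolding small_def l_def m_def by auto
  \<comment> \<open>Otherwise every class \<open>\<S> B\<close> shatters only small sets and is itself small; but the few
    classes with small \<open>B\<close> cover the whole power set of \<open>I\<close>.\<close>
  have "\<exists>B\<in>small l. \<exists>J\<subseteq>I. shatters (\<S> B) J \<and> k < card J"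
  proof (rule ccontr)
    assume neg: "\<not> ?thesis"
    have card_class: "card (\<S> B) \<le> card (small k)" if "B \<in> small l" for B
    proof -
      have "card (\<S> B) \<le> card {J. J \<subseteq> I \<and> shatters (\<S> B) J}"
        using fin by (intro card_le_card_shattered) (auto simp: \<S>_def)
      also have "\<dots> \<le> card (small k)"
        using neg that by (intro card_mono finsmall) (auto simp: small_def not_less)
      finally show ?thesis .
    qed
    have "2 ^ m = card (Pow I)"
      using fin by (simp add: card_Pow m_def)
    also have "\<dots> \<le> card (\<Union>B\<in>small l. \<S> B)"
      using fin bsmall by (intro card_mono finite_UN_I finsmall) (auto simp: \<S>_def)
    also have "\<dots> \<le> (\<Sum>B\<in>small l. card (\<S> B))"
      by (intro card_UN_le finsmall)
    also have "\<dots> \<le> card (small l) * card (small k)"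
      using sum_bounded_above[of "small l" "\<lambda>B. card (\<S> B)" "card (small k)"] card_class by simp
    finally have "(2::real) ^ m \<le> real (card (small l)) * real (card (small k))"
      by (metis of_nat_le_iff of_nat_mult of_nat_numeral of_nat_power)
    also have "\<dots> \<le> ((5/4) ^ m * 4 ^ l) * ((5/4) ^ m * 4 ^ k)"
      unfolding small_def m_def using fin by (intro mult_mono card_small_subsets_le) auto
    also have "\<dots> = (5/4) ^ m * (5/4) ^ m * 4 ^ (l + k)"
      by (simp add: power_add)
    also have "\<dots> < 2 ^ m"
      using m by (intro counting_bound) (auto simp: l_def k_def)
    finally show False by simp
  qed
  then obtain B J where B: "B \<in> small l" and J: "J \<subseteq> I" "shatters (\<S> B) J" "k < card J"
    by blast
  have "card J \<le> card (J - B) + card B"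
    using diff_card_le_card_Diff[of B J] B J(1) fin
    by (auto simp: small_def dest: finite_subset)
  then have "card I \<le> 16 * card (J - B)"
    using B J(3) m unfolding small_def l_def k_def m_def by auto
  moreover have "shatters {S. S \<subseteq> I \<and> b S \<inter> (J - B) = {}} (J - B)"
    unfolding shatters_def
  proof (intro allI impI)
    fix K assume "K \<subseteq> J - B"
    then obtain S where "S \<in> \<S> B" "S \<inter> J = K"
      using J(2) unfolding shatters_def by blast
    with \<open>K \<subseteq> J - B\<close> show "\<exists>S\<in>{S. S \<subseteq> I \<and> b S \<inter> (J - B) = {}}. S \<inter> (J - B) = K"
      unfolding \<S>_def by (intro bexI[of _ S]) auto
  qed
  ultimately show ?thesis using J(1) by blast
qed

section \<open>Points in most of finitely many large sets\<close>

text \<open>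
  The expected number of indices missed is at most \<open>\<delta> * |F|\<close>, so Markov's inequality applies.
\<close>

lemma (in prob_space) measure_in_most_ge:
  fixes \<beta> \<delta> :: real
  assumes fin: "finite F" and ne: "F \<noteq> {}" and "0 < \<beta>"
    and meas: "\<And>s. s \<in> F \<Longrightarrow> E s \<in> events"
    and large: "\<And>s. s \<in> F \<Longrightarrow> prob (E s) \<ge> 1 - \<delta>"
  defines "D \<equiv> {z\<in>space M. real (card {s\<in>F. z \<notin> E s}) \<le> \<beta> * card F}"
  shows "D \<in> events" and "prob D \<ge> 1 - \<delta> / \<beta>"
proof -
  define u where "u z = (\<Sum>s\<in>F. indicat_real (space M - E s) z)" for z
  have u_meas [measurable]: "u \<in> borel_measurable M"
    unfolding u_def using meas by (intro borel_measurable_sum) auto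
  have u: "u z = real (card {s\<in>F. z \<notin> E s})" if "z \<in> space M" for z
    using that fin by (simp add: u_def indicator_def sum.If_cases Int_def)
  have D: "D = {z\<in>space M. u z \<le> \<beta> * card F}"
    unfolding D_def using u by auto
  show ev: "D \<in> events"
    unfolding D by measurable
  have pos: "0 < \<beta> * card F"
    using assms(3) fin ne by (simp add: card_gt_0_iff)
  have int: "integrable M u"
    unfolding u_def using meas by (intro Bochner_Integration.integrable_sum) (auto simp: emeasure_eq_measure)
  have "prob (space M - D) \<le> prob {z\<in>space M. \<beta> * card F \<le> u z}"
    unfolding D by (intro finite_measure_mono) auto
  also have "\<dots> \<le> expectation u / (\<beta> * card F)"
    using int pos by (intro integral_Markov_inequality_measure[where A = "{}"])
      (simp_all add: u)
  also have "expectation u = (\<Sum>s\<in>F. prob (space M - E s))"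
    unfolding u_def using meas
    by (subst Bochner_Integration.integral_sum) (auto simp: emeasure_eq_measure)
  also have "\<dots> \<le> (\<Sum>s\<in>F. \<delta>)"
    using meas large by (intro sum_mono) (force simp: prob_compl)
  also have "(\<Sum>s\<in>F. \<delta>) / (\<beta> * card F) = \<delta> / \<beta>"
    using fin ne by simp
  finally show "prob D \<ge> 1 - \<delta> / \<beta>"
    using pos ev by (simp add: prob_compl divide_right_mono)
qed

section \<open>From one large set to a map of large sets\<close>

text \<open>
  Independence survives if the points that realise it may each escape a small part of the sets
  \<open>E s\<close>: discarding a fixed proportion of \<open>I\<close> repairs all of them at once.
\<close>

lemma independence_set_repair:
  assumes fin: "finite I"
    and ind: "independence_set act A1 A2 (\<lambda>_. D) I"
    and few: "\<And>z. z \<in> D \<Longrightarrow> 32 * card {s\<in>I. z \<notin> E s} \<le> card I"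
  shows "\<exists>J\<subseteq>I. independence_set act A1 A2 E J \<and> card I \<le> 16 * card J"
proof (cases "I = {}")
  case True
  then show ?thesis by (auto simp: independence_set_def)
next
  case False
  have "\<exists>z\<in>D. \<forall>s\<in>I. z \<in> act (- s) ` (if s \<in> S then A1 else A2)" for S
  proof -
    have choice: "(if s \<in> S then 1 else 2) = (1::nat) \<longleftrightarrow> s \<in> S" for s by simp
    have "(\<Inter>s\<in>I. D \<inter> act (- s) ` (if (if s \<in> S then 1 else 2) = (1::nat) then A1 else A2)) \<noteq> {}"
      using ind[unfolded independence_set_def, rule_format, of I "\<lambda>s. if s \<in> S then 1 else 2"]
        fin False by auto
    then have "(\<Inter>s\<in>I. D \<inter> act (- s) ` (if s \<in> S then A1 else A2)) \<noteq> {}"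
      unfolding choice .
    with False show ?thesis by blast
  qed
  then obtain z where zD: "\<And>S. z S \<in> D"
    and z: "\<And>S s. s \<in> I \<Longrightarrow> z S \<in> act (- s) ` (if s \<in> S then A1 else A2)"
    by metis
  obtain J where J: "J \<subseteq> I" "card I \<le> 16 * card J"
    and sh: "shatters {S. S \<subseteq> I \<and> {s\<in>I. z S \<notin> E s} \<inter> J = {}} J"
    using reliable_subsets_shatter[OF fin, of "\<lambda>S. {s\<in>I. z S \<notin> E s}"] few[OF zD] by auto
  have "independence_set act A1 A2 E J"
    unfolding independence_set_def
  proof (intro allI impI)
    fix F and \<sigma> :: "_ \<Rightarrow> nat"
    assume F: "F \<subseteq> J \<and> finite F \<and> F \<noteq> {} \<and> \<sigma> \<in> F \<rightarrow> {1, 2}"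
    then have "{s\<in>F. \<sigma> s = 1} \<subseteq> J" by blast
    then obtain S where S: "{s\<in>I. z S \<notin> E s} \<inter> J = {}" "S \<inter> J = {s\<in>F. \<sigma> s = 1}"
      using sh unfolding shatters_def by blast
    have "z S \<in> E s \<inter> act (- s) ` (if \<sigma> s = 1 then A1 else A2)" if "s \<in> F" for s
    proof -
      have s: "s \<in> I" "s \<in> J" using F J(1) that by auto
      have "s \<in> S \<longleftrightarrow> \<sigma> s = 1" using S(2) s that by blast
      with z[OF s(1), of S] S(1) s show ?thesis by auto
    qed
    then show "(\<Inter>s\<in>F. E s \<inter> act (- s) ` (if \<sigma> s = 1 then A1 else A2)) \<noteq> {}"
      by blast
  qed
  with J show ?thesis by blast
qed

lemma has_B_independence_if_has_independence:
  assumes "has_independence act \<mu> \<epsilon> A1 A2"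
  shows "has_B_independence act \<mu> \<epsilon> A1 A2"
proof -
  have single: "\<forall>D\<in>large_sets \<mu> \<epsilon>. P (\<lambda>_. D)" if "\<forall>E\<in>large_set_maps \<mu> \<epsilon>. P E" for P
    using that by (simp add: large_sets_def large_set_maps_def)
  show ?thesis
    using assms unfolding has_independence_def has_B_independence_def
    by (elim ex_forward conj_forward all_forward imp_forward) (assumption | erule single)+
qed

lemma has_independence_if_has_B_independence:
  assumes "prob_space \<mu>" and sets: "sets \<mu> = sets borel" and "0 < \<epsilon>"
    and B: "has_B_independence act \<mu> \<epsilon> A1 A2"
  shows "\<exists>\<delta>>0. has_independence act \<mu> \<delta> A1 A2"
proof -
  interpret prob_space \<mu> by fact
  obtain c where c: "0 < c" and ex: "\<And>N::nat. N > 0 \<Longrightarrow> \<exists>F. finite F \<and> card F > N \<and>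
      (\<forall>D\<in>large_sets \<mu> \<epsilon>. \<exists>I\<subseteq>F. independence_set act A1 A2 (\<lambda>_. D) I \<and>
         real (card I) \<ge> c * real (card F))"
    using B unfolding has_B_independence_def by blast
  have "has_independence act \<mu> (\<epsilon> * (c / 32)) A1 A2"
    unfolding has_independence_def
  proof (intro exI[of _ "c / 16"] conjI allI impI)
    show "0 < c / 16" using c by simp
    fix N :: nat assume "0 < N"
    from ex[OF this] obtain F where F: "finite F" "card F > N" and FD: "\<And>D. D \<in> large_sets \<mu> \<epsilon> \<Longrightarrow>
        \<exists>I\<subseteq>F. independence_set act A1 A2 (\<lambda>_. D) I \<and> real (card I) \<ge> c * real (card F)"
      by blast
    have "\<exists>J\<subseteq>F. independence_set act A1 A2 E J \<and> real (card J) \<ge> c / 16 * real (card F)"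
      if E: "E \<in> large_set_maps \<mu> (\<epsilon> * (c / 32))" for E
    proof -
      have E': "E s \<in> events" "prob (E s) \<ge> 1 - \<epsilon> * (c / 32)" for s
        using E sets by (simp_all add: large_set_maps_def)
      have ne: "F \<noteq> {}" using F(2) by auto
      define D where "D = {z\<in>space \<mu>. real (card {s\<in>F. z \<notin> E s}) \<le> c / 32 * card F}"
      have "D \<in> events" "prob D \<ge> 1 - \<epsilon> * (c / 32) / (c / 32)"
        unfolding D_def using c
        by (intro measure_in_most_ge[where \<delta> = "\<epsilon> * (c / 32)"] F(1) ne E'; simp)+
      then have "D \<in> large_sets \<mu> \<epsilon>"
        using c sets by (simp add: large_sets_def)
      then obtain I where I: "I \<subseteq> F" "independence_set act A1 A2 (\<lambda>_. D) I"
          "real (card I) \<ge> c * real (card F)"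
        using FD by blast
      have finI: "finite I" using I(1) F(1) finite_subset by blast
      \<comment> \<open>The threshold \<open>c / 32 * |F|\<close> in \<open>D\<close> is at most \<open>|I| / 32\<close>, since \<open>|I| \<ge> c * |F|\<close>.\<close>
      have few: "32 * card {s\<in>I. z \<notin> E s} \<le> card I" if "z \<in> D" for z
      proof -
        have "card {s\<in>I. z \<notin> E s} \<le> card {s\<in>F. z \<notin> E s}"
          using I(1) F(1) by (intro card_mono) auto
        then have "32 * real (card {s\<in>I. z \<notin> E s}) \<le> real (card I)"
          using that I(3) unfolding D_def by auto
        then show ?thesis by linarith
      qed
      obtain J where J: "J \<subseteq> I" "independence_set act A1 A2 E J" "card I \<le> 16 * card J"
        using independence_set_repair[OF finI I(2) few] by blast
      have "real (card J) \<ge> c / 16 * real (card F)"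
        using I(3) J(3) by auto
      with J(1,2) I(1) show ?thesis by blast
    qed
    with F show "\<exists>F. finite F \<and> card F > N \<and> (\<forall>E\<in>large_set_maps \<mu> (\<epsilon> * (c / 32)).
        \<exists>I\<subseteq>F. independence_set act A1 A2 E I \<and> real (card I) \<ge> c / 16 * real (card F))"
      by blast
  qed
  moreover have "0 < \<epsilon> * (c / 32)" using c assms(3) by simp
  ultimately show ?thesis by blast
qed

theorem theorem3p8:
  fixes act :: "'g::{ab_group_add, countable} \<Rightarrow> 'x::metric_space \<Rightarrow> 'x"
    and \<mu> :: "'x measure"
    and x y :: 'x
  assumes "compact (UNIV :: 'x set)"
    and "continuous_action act"
    and "ergodic_measure act \<mu>"
  shows "IN_pair act \<mu> (x, y) \<longleftrightarrow> B_IN_pair act \<mu> (x, y)"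
proof
  show "B_IN_pair act \<mu> (x, y)" if "IN_pair act \<mu> (x, y)"
    using that has_B_independence_if_has_independence
    unfolding IN_pair_def B_IN_pair_def by blast
  have "prob_space \<mu>" "sets \<mu> = sets borel"
    using assms(3) by (auto simp: ergodic_measure_def)
  then show "IN_pair act \<mu> (x, y)" if "B_IN_pair act \<mu> (x, y)"
    using that has_independence_if_has_B_independence
    unfolding IN_pair_def B_IN_pair_def by blast
qed

end
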